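(* $$\sum_{r=1}^\infty \frac{H_{r,2}^2}{r(r+1)}=\pi^2\,\zeta(3)-10\,\zeta(5) .$$
   Context: For a positive integer $N$, $H_{N,m}=\sum_{r=1}^N \frac{1}{r^m}$ is the generalized harmonic number of order $m$; $H_{r,2}^2$ denotes $(H_{r,2})^2$. $\zeta(m)=\sum_{r=1}^\infty r^{-m}$ is the Riemann zeta function. *)

theory Defs
  imports "HOL-Analysis.Analysis"
begin

definition gen_harm :: "nat \<Rightarrow> nat \<Rightarrow> real" where
  "gen_harm N m = (\<Sum>r = 1..N. 1 / real r ^ m)"

(* The series starts at r = 1, hence the Suc; it converges exactly for m \<ge> 2,
   and the value of suminf is meaningful only there. *)
definition zeta :: "nat \<Rightarrow> real" where
  "zeta m = (\<Sum>r. 1 / real (Suc r) ^ m)"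

end

theory Submission
  imports Defs
begin

text \<open>
  Summation by parts against 1/(r(r+1)) = 1/r - 1/(r+1) reduces the series to
  2 * (sum of H(r,2) / r^3) - zeta 5, so everything rests on the Euler sum of H(r,2) / r^3.
  Let T(a,b,c) be the sum of 1 / (n^a k^b (n+k)^c) over n, k >= 1. Then T(a,0,c) is the double
  zeta value with exponents c and a, and 1/(nk) = (1/n + 1/k)/(n+k) gives
  T(a+1,b+1,c) = T(a,b+1,c+1) + T(a+1,b,c+1).
  Three relations determine T(2,0,3): expanding zeta 2 * zeta 3 = T(2,3,0) by the recursion;
  splitting the same product along the diagonal; and evaluating T(3,1,1) both by the recursion
  and by summing over k first, which produces harmonic numbers. All terms are nonnegative, so
  rearrangements are harmless, and the convergent products of zeta values majorise every T used.
\<close>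

section \<open>Unordered sums over the positive integers and zeta values\<close>

lemma has_sum_atLeast1_iff_sums:
  fixes f :: "nat \<Rightarrow> real"
  assumes "\<And>n. 0 \<le> f (Suc n)"
  shows "(f has_sum S) {1..} \<longleftrightarrow> (\<lambda>n. f (Suc n)) sums S"
proof -
  have "bij_betw Suc UNIV {1..}"
    by (rule bij_betw_byWitness[where f' = "\<lambda>n. n - 1"]) auto
  from has_sum_reindex_bij_betw[OF this, of f S]
  have "(f has_sum S) {1..} \<longleftrightarrow> ((\<lambda>n. f (Suc n)) has_sum S) UNIV" by simp
  \<comment> \<open>Nonnegative terms make plain convergence unconditional.\<close>
  then show ?thesis
    using assms by (auto intro: has_sum_imp_sums sums_nonneg_imp_has_sum)
qed

lemma zeta_sums:
  assumes "2 \<le> m"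
  shows "(\<lambda>n. 1 / real (Suc n) ^ m) sums zeta m"
proof -
  have "summable (\<lambda>n. inverse (real n ^ m))"
    using assms by (rule inverse_power_summable)
  then have "summable (\<lambda>n. 1 / real (Suc n) ^ m)"
    by (subst summable_Suc_iff) (simp add: inverse_eq_divide)
  then show ?thesis
    unfolding zeta_def by (rule summable_sums)
qed

lemma zeta_has_sum:
  assumes "2 \<le> m"
  shows "((\<lambda>n::nat. 1 / real n ^ m) has_sum zeta m) {1..}"
  using zeta_sums[OF assms] by (subst has_sum_atLeast1_iff_sums) auto

lemma infsum_zeta: "2 \<le> m \<Longrightarrow> (\<Sum>\<^sub>\<infinity>n\<in>{1..}. 1 / real n ^ m) = zeta m"
  using zeta_has_sum by (rule infsumI)

lemma zeta_product_has_sum: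
  assumes "2 \<le> a" "2 \<le> b"
  shows "((\<lambda>(n, k). 1 / (real n ^ a * real k ^ b)) has_sum (zeta a * zeta b)) ({1..} \<times> {1..})"
proof -
  let ?f = "\<lambda>(n, k). 1 / (real n ^ a * real k ^ b)"
  have rows: "((\<lambda>k. ?f (n, k)) has_sum (1 / real n ^ a * zeta b)) {1..}" for n
    using has_sum_cmult_right[OF zeta_has_sum[OF assms(2)], of "1 / real n ^ a"] by simp
  have cols: "((\<lambda>n. 1 / real n ^ a * zeta b) has_sum (zeta a * zeta b)) {1..}"
    by (intro has_sum_cmult_left zeta_has_sum assms(1))
  have "?f summable_on ({1..} \<times> {1..})"
    using rows has_sum_imp_summable[OF cols] by (rule summable_on_SigmaI) auto
  with rows cols show ?thesis by (rule has_sum_SigmaI)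
qed

section \<open>Tornheim double series and their recursion\<close>

definition tornheim_term :: "nat \<Rightarrow> nat \<Rightarrow> nat \<Rightarrow> nat \<times> nat \<Rightarrow> real" where
  "tornheim_term a b c = (\<lambda>(n, k). 1 / (real n ^ a * real k ^ b * real (n + k) ^ c))"

text \<open>\<open>infsum\<close> is 0 on a non-summable family, so splitting a sum calls for
  separate summability facts about \<open>tornheim_term\<close>.\<close>

definition tornheim :: "nat \<Rightarrow> nat \<Rightarrow> nat \<Rightarrow> real" where
  "tornheim a b c = infsum (tornheim_term a b c) ({1..} \<times> {1..})"

lemma tornheim_swap: "tornheim a b c = tornheim b a c"
proof -
  have "infsum (tornheim_term a b c) ({1..} \<times> {1..}) =
        infsum (\<lambda>p. tornheim_term a b c (prod.swap p)) ({1..} \<times> {1..})"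
    by (rule infsum_reindex_bij_betw[symmetric])
       (auto intro!: bij_betw_byWitness[where f' = prod.swap])
  also have "(\<lambda>p. tornheim_term a b c (prod.swap p)) = tornheim_term b a c"
    by (auto simp: tornheim_term_def add.commute mult.commute)
  finally show ?thesis by (simp add: tornheim_def)
qed

lemma tornheim_zeta_product:
  assumes "2 \<le> a" "2 \<le> b"
  shows "tornheim a b 0 = zeta a * zeta b"
  using infsumI[OF zeta_product_has_sum[OF assms]] by (simp add: tornheim_def tornheim_term_def)

text \<open>Since n + k is at least n and at least k, (n + k)^(i + j) >= n^i k^j. Splitting the
  third exponent as i + j thus gives a product of two convergent zeta series as majorant.\<close>

lemma tornheim_summable:
  assumes "2 \<le> a + i" "2 \<le> b + j"
  shows "tornheim_term a b (i + j) summable_on ({1..} \<times> {1..})"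
proof (rule summable_on_comparison_test)
  show "(\<lambda>(n, k). 1 / (real n ^ (a + i) * real k ^ (b + j))) summable_on ({1..} \<times> {1..})"
    using zeta_product_has_sum[OF assms] by (rule has_sum_imp_summable)
next
  fix p :: "nat \<times> nat"
  assume "p \<in> {1..} \<times> {1..}"
  then obtain n k where p: "p = (n, k)" and nk: "n \<ge> 1" "k \<ge> 1" by auto
  have "real n ^ a * real k ^ b * (real n ^ i * real k ^ j) \<le>
        real n ^ a * real k ^ b * (real (n + k) ^ i * real (n + k) ^ j)"
    by (intro mult_left_mono mult_mono power_mono) auto
  then show "tornheim_term a b (i + j) p \<le> (case p of (n, k) \<Rightarrow> 1 / (real n ^ (a + i) * real k ^ (b + j)))"
    using nk unfolding p tornheim_term_def prod.case power_add
    by (intro divide_left_mono mult_pos_pos) (auto simp: mult_ac)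
qed (auto simp: tornheim_term_def)

lemma tornheim_rec:
  assumes "tornheim_term a (Suc b) (Suc c) summable_on ({1..} \<times> {1..})"
      and "tornheim_term (Suc a) b (Suc c) summable_on ({1..} \<times> {1..})"
  shows "tornheim (Suc a) (Suc b) c = tornheim a (Suc b) (Suc c) + tornheim (Suc a) b (Suc c)"
proof -
  have "tornheim_term (Suc a) (Suc b) c p = tornheim_term a (Suc b) (Suc c) p + tornheim_term (Suc a) b (Suc c) p"
    if p_in: "p \<in> {1..} \<times> {1..}" for p
  proof -
    obtain n k where p: "p = (n, k)" "n \<ge> 1" "k \<ge> 1" using p_in by auto
    \<comment> \<open>\<open>X\<close> is the factor common to the three terms; what remains is the
      partial fraction identity for 1/(nk).\<close>
    define X where "X = 1 / (real n ^ a * real k ^ b * real (n + k) ^ c)"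
    have "1 / (real n * real k) = 1 / (real k * real (n + k)) + 1 / (real n * real (n + k))"
      using p by (simp add: divide_simps)
    then have "X * (1 / (real n * real k)) = X * (1 / (real k * real (n + k))) + X * (1 / (real n * real (n + k)))"
      by (simp only: distrib_left)
    then show ?thesis
      by (simp add: X_def p tornheim_term_def mult_ac del: of_nat_add)
  qed
  then have "tornheim (Suc a) (Suc b) c =
      (\<Sum>\<^sub>\<infinity>p\<in>{1..} \<times> {1..}. tornheim_term a (Suc b) (Suc c) p + tornheim_term (Suc a) b (Suc c) p)"
    unfolding tornheim_def by (rule infsum_cong)
  also have "\<dots> = tornheim a (Suc b) (Suc c) + tornheim (Suc a) b (Suc c)"
    unfolding tornheim_def by (rule infsum_add[OF assms])
  finally show ?thesis .
qed

section \<open>Sums over n < m: double zeta values and Euler sums\<close>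

lemma bij_betw_below_diagonal:
  "bij_betw (\<lambda>(n, k). (n, n + k)) ({1..} \<times> {1..}) {(n, m). 1 \<le> n \<and> n < (m::nat)}"
  by (rule bij_betw_byWitness[where f' = "\<lambda>(n, m). (n, m - n)"]) auto

lemma tornheim_below_diagonal:
  "tornheim a 0 c = (\<Sum>\<^sub>\<infinity>(n, m)\<in>{(n, m). 1 \<le> n \<and> n < m}. 1 / (real n ^ a * real m ^ c))"
  unfolding tornheim_def tornheim_term_def
    infsum_reindex_bij_betw[OF bij_betw_below_diagonal, symmetric]
  by (simp add: case_prod_unfold)

lemma infsum_diagonal:
  "2 \<le> a + c \<Longrightarrow> (\<Sum>\<^sub>\<infinity>(n, m)\<in>(\<lambda>n. (n, n)) ` {1..}. 1 / (real n ^ a * real m ^ c)) = zeta (a + c)"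
  using infsum_zeta[of "a + c"]
  by (subst infsum_reindex) (auto simp: inj_on_def o_def power_add)

lemma diagonal_summable:
  assumes "2 \<le> a + c"
  shows "(\<lambda>(n, m). 1 / (real n ^ a * real m ^ c)) summable_on (\<lambda>n. (n, n)) ` {1..}"
  using has_sum_imp_summable[OF zeta_has_sum[OF assms]]
  by (subst summable_on_reindex) (auto simp: inj_on_def o_def power_add)

lemma below_diagonal_summable:
  assumes "tornheim_term a 0 c summable_on ({1..} \<times> {1..})"
  shows "(\<lambda>(n, m). 1 / (real n ^ a * real m ^ c)) summable_on {(n, m). 1 \<le> n \<and> n < m}"
  using assms
  unfolding tornheim_term_def summable_on_reindex_bij_betw[OF bij_betw_below_diagonal, symmetric]
  by (simp add: case_prod_unfold)

text \<open>The quadrant splits into n < m, m < n and n = m; swapping coordinates turns the second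
  region into the first with the exponents exchanged.\<close>

lemma zeta_stuffle:
  assumes "2 \<le> a" "2 \<le> b"
  shows "zeta a * zeta b = tornheim a 0 b + tornheim b 0 a + zeta (a + b)"
proof -
  let ?f = "\<lambda>(n, m). 1 / (real n ^ a * real m ^ b)"
  let ?L = "{(n, m). 1 \<le> n \<and> n < (m::nat)}"
  let ?U = "{(n, m). 1 \<le> m \<and> m < (n::nat)}"
  let ?D = "(\<lambda>n. (n, n)) ` {1::nat..}"
  have sm: "?f summable_on ({1..} \<times> {1..})"
    using zeta_product_has_sum[OF assms] by (rule has_sum_imp_summable)
  have U: "{1..} \<times> {1..} = ?L \<union> ?U \<union> ?D" by auto
  have sL: "?f summable_on ?L" and sU: "?f summable_on ?U" and sD: "?f summable_on ?D" 
    by (rule summable_on_subset_banach[OF sm]; auto)+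
  have "zeta a * zeta b = infsum ?f ({1..} \<times> {1..})"
    using infsumI[OF zeta_product_has_sum[OF assms]] by simp
  also have "\<dots> = infsum ?f (?L \<union> ?U) + infsum ?f ?D"
    unfolding U by (rule infsum_Un_disjoint[OF summable_on_Un_disjoint[OF sL sU] sD]) auto
  also have "infsum ?f (?L \<union> ?U) = infsum ?f ?L + infsum ?f ?U"
    by (rule infsum_Un_disjoint[OF sL sU]) auto
  also have "infsum ?f ?U = infsum (\<lambda>p. ?f (prod.swap p)) ?L"
    by (rule infsum_reindex_bij_betw[symmetric])
       (auto intro!: bij_betw_byWitness[where f' = prod.swap])
  also have "\<dots> = tornheim b 0 a"
    unfolding tornheim_below_diagonal by (intro infsum_cong) (auto simp: mult.commute)
  finally show ?thesis
    using assms by (simp add: tornheim_below_diagonal infsum_diagonal del: One_nat_def)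
qed

text \<open>Adding the diagonal to n < m gives n <= m; for fixed m the sum over n is then finite and
  produces the harmonic number.\<close>

lemma euler_sum_has_sum:
  assumes "2 \<le> c" "tornheim_term a 0 c summable_on ({1..} \<times> {1..})"
  shows "((\<lambda>m. gen_harm m a / real m ^ c) has_sum (tornheim a 0 c + zeta (a + c))) {1..}"
proof -
  let ?f = "\<lambda>(n, m). 1 / (real n ^ a * real m ^ c)"
  let ?L = "{(n, m). 1 \<le> n \<and> n < (m::nat)}"
  let ?D = "(\<lambda>n. (n, n)) ` {1::nat..}"
  have sL: "?f summable_on ?L" using assms(2) by (rule below_diagonal_summable)
  have sD: "?f summable_on ?D" using assms(1) by (intro diagonal_summable) auto
  have "(?f has_sum (infsum ?f ?L + infsum ?f ?D)) (?L \<union> ?D)"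
    using sL sD by (intro has_sum_Un_disjoint has_sum_infsum) auto
  then have "(?f has_sum (tornheim a 0 c + zeta (a + c))) (?L \<union> ?D)"
    using assms(1) by (simp add: tornheim_below_diagonal infsum_diagonal del: One_nat_def)
  \<comment> \<open>The swap puts m first, so that the fibres are the finite sets
    \<open>{1..m}\<close>.\<close>
  moreover have "bij_betw prod.swap (SIGMA m:{1..}. {1..m}) (?L \<union> ?D)"
    by (rule bij_betw_byWitness[where f' = prod.swap]) auto
  ultimately have "((\<lambda>p. ?f (prod.swap p)) has_sum (tornheim a 0 c + zeta (a + c))) (SIGMA m:{1..}. {1..m})"
    using has_sum_reindex_bij_betw by blast
  then show ?thesis
  proof (rule has_sum_SigmaD)
    fix m :: nat assume "m \<in> {1..}"
    have "(\<Sum>n = 1..m. 1 / (real n ^ a * real m ^ c)) = gen_harm m a / real m ^ c"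
      by (simp add: gen_harm_def sum_divide_distrib)
    then show "((\<lambda>n. ?f (prod.swap (m, n))) has_sum gen_harm m a / real m ^ c) {1..m}"
      by (intro has_sum_finiteI) auto
  qed
qed

section \<open>Harmonic numbers from summing over k first\<close>

lemma harmonic_telescope:
  assumes "1 \<le> n"
  shows "((\<lambda>k. real n / (real k * real (n + k))) has_sum gen_harm n 1) {1..}"
proof -
  \<comment> \<open>The term is 1/k - 1/(n + k), so N terms leave H(n,1) minus 1/(N+1) + ... +
    1/(N+n). As n is fixed, this remainder tends to 0.\<close>
  have part: "(\<Sum>k<N. real n / (real (Suc k) * real (n + Suc k))) =
      gen_harm n 1 - (\<Sum>j = 1..n. 1 / real (N + j))" for N
  proof (induction N)
    case 0
    then show ?case by (simp add: gen_harm_def)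
  next
    case (Suc N)
    \<comment> \<open>Shifting the window by one changes only its two ends; the change is the
      negative of the new term.\<close>
    have "(\<Sum>j = 1..n. 1 / real (Suc N + j)) - (\<Sum>j = 1..n. 1 / real (N + j)) =
          (\<Sum>j = 1..n. 1 / real (N + Suc j) - 1 / real (N + j))"
      by (simp add: sum_subtractf)
    also have "\<dots> = 1 / real (N + Suc n) - 1 / real (N + 1)"
      using sum_Suc_diff[of 1 n "\<lambda>j. 1 / real (N + j)"] assms by simp
    also have "\<dots> = - real n / (real (Suc N) * real (n + Suc N))"
      by (simp add: divide_simps)
    finally show ?case using Suc by simp
  qed
  have "(\<lambda>N. 1 / real (N + j)) \<longlonglongrightarrow> 0" for j
    using LIMSEQ_ignore_initial_segment[OF lim_1_over_n] by simp
  then have "(\<lambda>N. gen_harm n 1 - (\<Sum>j = 1..n. 1 / real (N + j))) \<longlonglongrightarrow> gen_harm n 1 - (\<Sum>j = 1..n. 0)"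
    by (intro tendsto_intros)
  then have "(\<lambda>k. real n / (real (Suc k) * real (n + Suc k))) sums gen_harm n 1"
    unfolding sums_def part by simp
  then show ?thesis by (subst has_sum_atLeast1_iff_sums) auto
qed

text \<open>For fixed n, 1/(n^a k (n + k)) is 1/n^(a+1) times the telescoping term. Summing over k
  first gives the Euler sum of H(n,1)/n^(a+1), which \<open>euler_sum_has_sum\<close> also
  evaluates.\<close>

lemma tornheim_harmonic:
  assumes "2 \<le> a"
  shows "tornheim a 1 1 = tornheim 1 0 (Suc a) + zeta (a + 2)"
proof -
  have s: "tornheim_term a 1 1 summable_on ({1..} \<times> {1..})"
    using tornheim_summable[of a 0 1 1] assms by simp
  then have h: "(tornheim_term a 1 1 has_sum tornheim a 1 1) ({1..} \<times> {1..})"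
    unfolding tornheim_def by (rule has_sum_infsum)
  have "((\<lambda>n. gen_harm n 1 / real n ^ Suc a) has_sum tornheim a 1 1) {1..}"
  proof (rule has_sum_SigmaD[OF h])
    fix n :: nat assume n: "n \<in> {1..}"
    have "((\<lambda>k. 1 / real n ^ Suc a * (real n / (real k * real (n + k)))) has_sum
           1 / real n ^ Suc a * gen_harm n 1) {1..}"
      using n by (intro has_sum_cmult_right harmonic_telescope) auto
    then show "((\<lambda>k. tornheim_term a 1 1 (n, k)) has_sum gen_harm n 1 / real n ^ Suc a) {1..}"
      using n by (simp add: tornheim_term_def mult_ac)
  qed
  moreover have "tornheim_term 1 0 (Suc a) summable_on ({1..} \<times> {1..})"
    using tornheim_summable[of 1 "a - 1" 0 2] assms by simp
  then have "((\<lambda>n. gen_harm n 1 / real n ^ Suc a) has_sum (tornheim 1 0 (Suc a) + zeta (1 + Suc a))) {1..}"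
    using assms by (intro euler_sum_has_sum) auto
  ultimately show ?thesis using has_sum_unique by fastforce
qed

section \<open>The linear system at total exponent 5\<close>

lemma tornheim_2_0_3: "tornheim 2 0 3 = 3 * zeta 2 * zeta 3 - 11 / 2 * zeta 5"
proof -
  \<comment> \<open>The share i of the exponent c goes to n, the rest to k.\<close>
  have s: "tornheim_term a b c summable_on ({1..} \<times> {1..})"
    if "\<exists>i\<le>c. 2 \<le> a + i \<and> 2 \<le> b + (c - i)" for a b c
  proof -
    from that obtain i where "i \<le> c" "2 \<le> a + i" "2 \<le> b + (c - i)" by blast
    then show ?thesis using tornheim_summable[of a i b "c - i"] by simp
  qed
  have rec: "tornheim (Suc a) (Suc b) c = tornheim a (Suc b) (Suc c) + tornheim (Suc a) b (Suc c)"
    if "a + b + c = 3" "1 \<le> c \<or> 1 \<le> a" "1 \<le> c \<or> 1 \<le> b" for a b c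
  proof (rule tornheim_rec)
    show "tornheim_term a (Suc b) (Suc c) summable_on ({1..} \<times> {1..})"
      \<comment> \<open>The least share that raises the exponent of n to 2; the subtraction
        truncates.\<close>
      using that by (intro s exI[of _ "2 - a"]) auto
    show "tornheim_term (Suc a) b (Suc c) summable_on ({1..} \<times> {1..})"
      \<comment> \<open>This leaves k an exponent of at least 2: if b = 0 then c >= 1 and k receives
        exactly 2; if c = 0 then \<open>c - 1\<close> truncates to 0.\<close>
      using that by (intro s exI[of _ "c - 1 + (if b \<ge> 1 then b - 1 else 0)"]) (auto split: if_splits)
  qed
  \<comment> \<open>With A = T(1,0,4), B = T(2,0,3), C = T(3,0,2) and P = zeta 2 * zeta 3, the facts
    below reduce to P = 6A + 3B + C, A + B + C = zeta 5 and P = B + C + zeta 5. Hence A = 2 zeta 5 -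
    P and 2B = 6P - 11 zeta 5.\<close>
  have "tornheim 2 3 0 = tornheim 1 3 1 + tornheim 2 2 1"
    using rec[of 1 2 0] by (simp add: eval_nat_numeral)
  moreover have "tornheim 1 3 1 = tornheim 0 3 2 + tornheim 1 2 2"
    using rec[of 0 2 1] by (simp add: eval_nat_numeral)
  moreover have "tornheim 2 2 1 = tornheim 1 2 2 + tornheim 2 1 2"
    using rec[of 1 1 1] by (simp add: eval_nat_numeral)
  moreover have "tornheim 1 2 2 = tornheim 0 2 3 + tornheim 1 1 3"
    using rec[of 0 1 2] by (simp add: eval_nat_numeral)
  moreover have "tornheim 1 1 3 = tornheim 0 1 4 + tornheim 1 0 4"
    using rec[of 0 0 3] by (simp add: eval_nat_numeral)
  moreover have "tornheim 3 1 1 = tornheim 2 1 2 + tornheim 3 0 2"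
    using rec[of 2 0 1] by (simp add: eval_nat_numeral)
  moreover have "tornheim 3 1 1 = tornheim 1 0 4 + zeta 5"
    using tornheim_harmonic[of 3] by simp
  moreover have "zeta 2 * zeta 3 = tornheim 2 0 3 + tornheim 3 0 2 + zeta 5"
    using zeta_stuffle[of 2 3] by simp
  moreover have "tornheim 2 3 0 = zeta 2 * zeta 3"
    by (rule tornheim_zeta_product) auto
  moreover note tornheim_swap[of 0 3 2] tornheim_swap[of 0 2 3] tornheim_swap[of 0 1 4]
    tornheim_swap[of 2 1 2]
  ultimately show ?thesis by linarith
qed

section \<open>Summation by parts and passage to the limit\<close>

lemma sum_by_parts_gen_harm:
  "(\<Sum>r<N. (gen_harm (Suc r) 2)\<^sup>2 / (real (Suc r) * (real (Suc r) + 1))) =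
   (\<Sum>r<N. 2 * (gen_harm (Suc r) 2 / real (Suc r) ^ 3) - 1 / real (Suc r) ^ 5)
     - (gen_harm N 2)\<^sup>2 / (real N + 1)"
proof (induction N)
  case 0
  then show ?case by (simp add: gen_harm_def)
next
  case (Suc N)
  define h where "h = gen_harm N 2"
  define x where "x = real N + 1"
  have x: "x > 0" by (simp add: x_def)
  have H: "gen_harm (Suc N) 2 = h + 1 / x\<^sup>2"
    by (simp add: gen_harm_def h_def x_def add.commute)
  \<comment> \<open>The last term is the new boundary term; the h^2/x split off next cancels the old
    one.\<close>
  have "(h + 1 / x\<^sup>2)\<^sup>2 / (x * (x + 1)) = (h + 1 / x\<^sup>2)\<^sup>2 / x - (h + 1 / x\<^sup>2)\<^sup>2 / (x + 1)"
    using x by (simp add: divide_simps) (simp add: algebra_simps)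
  \<comment> \<open>With H = h + 1/x^2, H^2 - h^2 = (2H - 1/x^2)/x^2.\<close>
  also have "(h + 1 / x\<^sup>2)\<^sup>2 / x = h\<^sup>2 / x + (2 * ((h + 1 / x\<^sup>2) / x ^ 3) - 1 / x ^ 5)"
    using x by (simp add: field_simps eval_nat_numeral)
  finally show ?case
    using Suc H by (simp add: x_def h_def add.commute)
qed

theorem mainTheorem4:
  shows "(\<lambda>r. (gen_harm (Suc r) 2)\<^sup>2 / (real (Suc r) * (real (Suc r) + 1)))
           sums (pi\<^sup>2 * zeta 3 - 10 * zeta 5)"
proof -
  have z2: "zeta 2 = pi\<^sup>2 / 6"
    using inverse_squares_sums unfolding zeta_def by (simp add: sums_iff add.commute)
  have "tornheim_term 2 0 3 summable_on ({1..} \<times> {1..})"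
    using tornheim_summable[of 2 1 0 2] by (simp del: One_nat_def)
  then have "((\<lambda>m. gen_harm m 2 / real m ^ 3) has_sum (tornheim 2 0 3 + zeta 5)) {1..}"
    using euler_sum_has_sum[of 3 2] by simp
  then have "(\<lambda>r. gen_harm (Suc r) 2 / real (Suc r) ^ 3) sums (tornheim 2 0 3 + zeta 5)"
    by (subst (asm) has_sum_atLeast1_iff_sums) (auto simp: gen_harm_def sum_nonneg)
  moreover have "(\<lambda>r. 1 / real (Suc r) ^ 5) sums zeta 5"
    by (intro zeta_sums) simp
  ultimately have "(\<lambda>r. 2 * (gen_harm (Suc r) 2 / real (Suc r) ^ 3) - 1 / real (Suc r) ^ 5)
      sums (2 * (tornheim 2 0 3 + zeta 5) - zeta 5)"
    by (intro sums_diff sums_mult)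
  \<comment> \<open>6 * zeta 2 = pi^2, and 2 * (-11/2 + 1) - 1 = -10.\<close>
  moreover have "2 * (tornheim 2 0 3 + zeta 5) - zeta 5 = pi\<^sup>2 * zeta 3 - 10 * zeta 5"
    by (simp add: tornheim_2_0_3 z2)
  ultimately have "(\<lambda>r. 2 * (gen_harm (Suc r) 2 / real (Suc r) ^ 3) - 1 / real (Suc r) ^ 5)
      sums (pi\<^sup>2 * zeta 3 - 10 * zeta 5)"
    by (simp only:)
  then have main: "(\<lambda>N. \<Sum>r<N. 2 * (gen_harm (Suc r) 2 / real (Suc r) ^ 3) - 1 / real (Suc r) ^ 5)
      \<longlonglongrightarrow> pi\<^sup>2 * zeta 3 - 10 * zeta 5"
    by (simp only: sums_def)
  have "(\<lambda>r. 1 / real (Suc r) ^ 2) sums zeta 2"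
    by (intro zeta_sums) simp
  then have "(\<lambda>N. gen_harm N 2) \<longlonglongrightarrow> zeta 2"
    unfolding sums_def gen_harm_def
    by (simp only: One_nat_def sum.atLeast1_atMost_eq)
  \<comment> \<open>The boundary term vanishes because H(N,2) converges.\<close>
  then have "(\<lambda>N. (gen_harm N 2)\<^sup>2 * (1 / (real N + 1))) \<longlonglongrightarrow> (zeta 2)\<^sup>2 * 0"
    using LIMSEQ_Suc[OF lim_1_over_n[where 'a = real]] \<open>(\<lambda>N. gen_harm N 2) \<longlonglongrightarrow> zeta 2\<close>
    by (intro tendsto_mult tendsto_power) (simp_all add: add.commute)
  from tendsto_diff[OF main this] show ?thesis
    unfolding sums_def sum_by_parts_gen_harm by simp
qed

end
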